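(* Let $(c_{i,j})_{i\ge0,\,j>0}$ be complex numbers, only finitely many of which are nonzero. Then $$\tau=\exp\Big(\sum_{i\ge0,\,j>0}c_{i,j}\,\varphi^{*}_{-i}\varphi_{-j}\Big)|0\rangle\in\widetilde{\mathcal{M}}$$ satisfies $$\Omega_U(\tau\otimes\tau)=0,\qquad \Omega_{U}=\sum_{i\in\mathbb{Z}}\varphi^{*}_{i}\otimes\varphi_{-i}.$$
   Context: The charged free bosons are operators $\varphi_i,\varphi^*_i$ ($i\in\mathbb{Z}$) with commutation relations $[\varphi_i,\varphi^*_j]=\delta_{i,-j}$, $[\varphi_i,\varphi_j]=[\varphi^*_i,\varphi^*_j]=0$. The Fock space $\mathcal{M}$ is generated by a vacuum vector $|0\rangle$ with $\varphi_i|0\rangle=\varphi^*_{i+1}|0\rangle=0$ for $i\ge 0$; as a vector space $\mathcal{M}\simeq\mathbb{C}[\varphi_{-i-1},\varphi^*_{-i}\mid i\ge 0]\,|0\rangle$. Its completion is the formal power series space $\widetilde{\mathcal{M}}=\mathbb{C}[[\varphi_{-i-1},\varphi^*_{-i}\mid i\ge 0]]\,|0\rangle$. On both spaces $\varphi_{-i-1},\varphi^*_{-i}$ ($i\ge0$) act by multiplication, $\varphi_i$ ($i\ge0$) acts as $\partial/\partial\varphi^*_{-i}$ and $\varphi^*_i$ ($i\ge1$) acts as $-\partial/\partial\varphi_{-i}$. The expression $\Omega_U(\tau\otimes\tau)$ is understood in the completed tensor square of $\widetilde{\mathcal{M}}$, i.e. formal power series in two independent copies of the variables $\varphi_{-i-1},\varphi^*_{-i}$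 (first tensor factor acting on the first copy, second on the second copy); each coefficient of $\Omega_U(\tau\otimes\tau)$ is a finite sum. *)

theory Defs
  imports Complex_Main "HOL-Library.Multiset"
begin

section \<open>Formal power series in arbitrarily many variables\<close>

text \<open>
  A monomial is a finite multiset of variables (the multiplicity of a variable is its exponent).
  A formal power series is an arbitrary family of coefficients indexed by the monomials, with
  the Cauchy product.
\<close>

typedef 'v mfps = "UNIV :: ('v multiset \<Rightarrow> complex) set"
  morphisms coeff Abs_mfps by simp

lemmas coeff_Abs [simp] = Abs_mfps_inverse [OF UNIV_I]

lemma mfps_eqI: "(\<And>m. coeff F m = coeff G m) \<Longrightarrow> F = G"
  by (metis coeff_inject ext)

lemma finite_submultisets [simp]: "finite {a. a \<subseteq># m}"
proof (induction m)
  case (add x m)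
  have "{a. a \<subseteq># add_mset x m} \<subseteq> {a. a \<subseteq># m} \<union> add_mset x ` {a. a \<subseteq># m}"
  proof
    fix a assume "a \<in> {a. a \<subseteq># add_mset x m}"
    then have a: "a \<subseteq># add_mset x m" by simp
    show "a \<in> {a. a \<subseteq># m} \<union> add_mset x ` {a. a \<subseteq># m}"
    proof (cases "x \<in># a")
      case True
      then obtain b where "a = add_mset x b" by (meson multi_member_split)
      with a show ?thesis by auto
    next
      case False
      with a have "a \<subseteq># m" by (metis add_mset_remove_trivial diff_subset_eq_self
            diff_single_trivial mset_subset_eq_exists_conv subset_mset.order_trans
            minus_add_mset_if_not_in_lhs subset_eq_diff_conv add_mset_add_single)
      then show ?thesis by simp
    qed
  qed
  then show ?case using add finite_subset by blast
qed simp

instantiation mfps :: (type) comm_ring_1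
begin

definition "0 = Abs_mfps (\<lambda>_. 0)"
definition "1 = Abs_mfps (\<lambda>m. if m = {#} then 1 else 0)"
definition "F + G = Abs_mfps (\<lambda>m. coeff F m + coeff G m)"
definition "F - G = Abs_mfps (\<lambda>m. coeff F m - coeff G m)"
definition "- F = Abs_mfps (\<lambda>m. - coeff F m)"
definition "F * G = Abs_mfps (\<lambda>m. \<Sum>a | a \<subseteq># m. coeff F a * coeff G (m - a))"

instance
proof
  fix F G H :: "'a mfps"
  show "F * G * H = F * (G * H)"
  proof (rule mfps_eqI)
    fix m
    have "coeff (F * G * H) m =
        (\<Sum>(a,b)\<in>Sigma {a. a \<subseteq># m} (\<lambda>a. {b. b \<subseteq># a}). coeff F b * coeff G (a - b) * coeff H (m - a))"
      by (simp add: times_mfps_def sum_distrib_right sum.Sigma)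
    also have "\<dots> = (\<Sum>(a,b)\<in>Sigma {a. a \<subseteq># m} (\<lambda>a. {b. b \<subseteq># m - a}).
        coeff F a * (coeff G b * coeff H (m - a - b)))"
      by (rule sum.reindex_bij_witness[where i = "\<lambda>(a,b). (a + b, a)" and j = "\<lambda>(a,b). (b, a - b)"])
        (auto simp: subset_mset.le_diff_conv2 algebra_simps intro: subset_mset.order_trans)
    also have "\<dots> = coeff (F * (G * H)) m"
      by (simp add: times_mfps_def sum_distrib_left sum.Sigma)
    finally show "coeff (F * G * H) m = coeff (F * (G * H)) m" .
  qed
  show "F * G = G * F"
  proof (rule mfps_eqI)
    fix m
    show "coeff (F * G) m = coeff (G * F) m"
      unfolding times_mfps_def coeff_Abs
      by (rule sum.reindex_bij_witness[where i = "\<lambda>a. m - a" and j = "\<lambda>a. m - a"])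
        (auto simp: subset_mset.diff_diff_right)
  qed
  show "1 * F = F"
  proof (rule mfps_eqI)
    fix m
    have "coeff (1 * F) m = (\<Sum>a | a \<subseteq># m. if a = {#} then coeff F m else 0)"
      unfolding times_mfps_def one_mfps_def coeff_Abs by (rule sum.cong) auto
    then show "coeff (1 * F) m = coeff F m" by (simp add: sum.delta)
  qed
  show "(F + G) * H = F * H + G * H"
    by (simp add: times_mfps_def plus_mfps_def sum.distrib algebra_simps)
  show "(0 :: 'a mfps) \<noteq> 1"
    by (auto simp: zero_mfps_def one_mfps_def Abs_mfps_inject fun_eq_iff)
qed (simp_all add: plus_mfps_def minus_mfps_def uminus_mfps_def zero_mfps_def coeff_inverse algebra_simps)

end

definition mfps_const :: "complex \<Rightarrow> 'v mfps" where
  "mfps_const c = Abs_mfps (\<lambda>m. if m = {#} then c else 0)"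

definition mfps_var :: "'v \<Rightarrow> 'v mfps" where
  "mfps_var v = Abs_mfps (\<lambda>m. if m = {#v#} then 1 else 0)"

definition mfps_deriv :: "'v \<Rightarrow> 'v mfps \<Rightarrow> 'v mfps" where
  "mfps_deriv v F = Abs_mfps (\<lambda>m. of_nat (count m v + 1) * coeff F (add_mset v m))"

text \<open>
  The exponential is taken coefficientwise. For a series without constant term only finitely many
  powers contribute to each coefficient (see the lemma after the definition).
\<close>

definition mfps_exp :: "'v mfps \<Rightarrow> 'v mfps" where
  "mfps_exp F = Abs_mfps (\<lambda>m. \<Sum>k. coeff (F ^ k) m / fact k)"

lemma coeff_power_eq_0:
  assumes "coeff F {#} = 0" and "size m < k"
  shows "coeff (F ^ k) m = 0"
  using assms(2)
proof (induction k arbitrary: m)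
  case (Suc k)
  have "coeff F a * coeff (F ^ k) (m - a) = 0" if "a \<subseteq># m" for a
  proof (cases "a = {#}")
    case False
    then have "size (m - a) < k"
      using that Suc.prems size_mset_mono[OF that] by (simp add: size_Diff_submset)
         (metis Suc_leI diff_less le_less_trans less_Suc_eq_le less_le_trans linorder_not_less
           nonempty_has_size not_less_eq order_less_le_trans)
    then show ?thesis using Suc.IH by simp
  qed (simp add: assms)
  then show ?case by (simp add: times_mfps_def sum.neutral)
qed simp

lemma coeff_mfps_exp:
  assumes "coeff F {#} = 0"
  shows "coeff (mfps_exp F) m = (\<Sum>k\<le>size m. coeff (F ^ k) m / fact k)"
  unfolding mfps_exp_def coeff_Abs
  by (rule suminf_finite) (auto simp: coeff_power_eq_0[OF assms])

lemma coeff_var_mult: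
  "coeff (mfps_var v * F) m = (if v \<in># m then coeff F (m - {#v#}) else 0)"
proof -
  have "coeff (mfps_var v * F) m =
      (\<Sum>a | a \<subseteq># m. if a = {#v#} then coeff F (m - {#v#}) else 0)"
    unfolding times_mfps_def mfps_var_def coeff_Abs by (rule sum.cong) auto
  then show ?thesis by (simp add: sum.delta)
qed


section \<open>Charged free bosons\<close>

text \<open>
  The free variables of the Fock space: \<open>Phi i\<close> stands for \<open>\<phi>\<close> with index \<open>- i - 1\<close>, and
  \<open>PhiStar i\<close> for \<open>\<phi>\<^sup>*\<close> with index \<open>- i\<close>. Thus \<open>fock_var mfps\<close> is the completed Fock space, the
  vacuum vector being the constant series \<open>1\<close>; \<open>(fock_var + fock_var) mfps\<close> is its completed
  tensor square, \<open>Inl\<close> and \<open>Inr\<close> marking the two copies of the variables.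
\<close>

datatype fock_var = Phi nat | PhiStar nat

abbreviation vacuum :: "fock_var mfps" where
  "vacuum \<equiv> 1"

text \<open>
  The operators are defined for an embedding \<open>e\<close> of the variables into a possibly larger set of
  variables: \<open>e = id\<close> gives the action on the completed Fock space, and \<open>e = Inl\<close>, \<open>e = Inr\<close> give
  the action on the first and on the second factor of the completed tensor square.
\<close>

definition phi :: "(fock_var \<Rightarrow> 'v) \<Rightarrow> int \<Rightarrow> 'v mfps \<Rightarrow> 'v mfps" where
  "phi e i F = (if i < 0 then mfps_var (e (Phi (nat (- i - 1)))) * F
                else mfps_deriv (e (PhiStar (nat i))) F)"

definition phi_star :: "(fock_var \<Rightarrow> 'v) \<Rightarrow> int \<Rightarrow> 'v mfps \<Rightarrow> 'v mfps" where
  "phi_star e i F = (if i \<le> 0 then mfps_var (e (PhiStar (nat (- i)))) * F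
                     else - mfps_deriv (e (Phi (nat (i - 1)))) F)"

definition left_part :: "('v + 'w) multiset \<Rightarrow> 'v multiset" where
  "left_part m = image_mset projl (filter_mset isl m)"

definition right_part :: "('v + 'w) multiset \<Rightarrow> 'w multiset" where
  "right_part m = image_mset projr (filter_mset (\<lambda>x. \<not> isl x) m)"

definition tensor :: "'v mfps \<Rightarrow> 'w mfps \<Rightarrow> ('v + 'w) mfps"  (infixr "\<otimes>" 75) where
  "F \<otimes> G = Abs_mfps (\<lambda>m. coeff F (left_part m) * coeff G (right_part m))"

text \<open>\<open>omega_term i\<close> is the operator \<open>\<phi>\<^sup>*\<^sub>i \<otimes> \<phi>\<^sub>-\<^sub>i\<close>.\<close>

definition omega_term :: "int \<Rightarrow> (fock_var + fock_var) mfps \<Rightarrow> (fock_var + fock_var) mfps" where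
  "omega_term i F = phi_star Inl i (phi Inr (- i) F)"

text \<open>
  The sum over all integers \<open>i\<close> is taken coefficientwise; by the lemma \<open>finite_omega_support\<close> below
  each coefficient is a finite sum, so no value is assigned by convention.
\<close>

definition Omega_U :: "(fock_var + fock_var) mfps \<Rightarrow> (fock_var + fock_var) mfps" where
  "Omega_U F = Abs_mfps (\<lambda>m. \<Sum>i | coeff (omega_term i F) m \<noteq> 0. coeff (omega_term i F) m)"

lemma finite_omega_support: "finite {i. coeff (omega_term i F) m \<noteq> 0}"
proof -
  let ?f = "\<lambda>x. case x of Inl (PhiStar n) \<Rightarrow> - int n | Inr (Phi n) \<Rightarrow> int n + 1 | _ \<Rightarrow> 0"
  have "i \<in> ?f ` set_mset m" if "coeff (omega_term i F) m \<noteq> 0" for i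
  proof (cases "i \<le> 0")
    case True
    with that have "Inl (PhiStar (nat (- i))) \<in># m"
      by (auto simp: omega_term_def phi_star_def coeff_var_mult split: if_splits)
    then have "?f (Inl (PhiStar (nat (- i)))) \<in> ?f ` set_mset m" by (rule imageI)
    with True show ?thesis by simp
  next
    case False
    with that have "Inr (Phi (nat (i - 1))) \<in># m"
      by (auto simp: omega_term_def phi_star_def phi_def mfps_deriv_def uminus_mfps_def
          coeff_var_mult split: if_splits)
    then have "?f (Inr (Phi (nat (i - 1)))) \<in> ?f ` set_mset m" by (rule imageI)
    with False show ?thesis by simp
  qed
  then have "{i. coeff (omega_term i F) m \<noteq> 0} \<subseteq> ?f ` set_mset m" by blast
  then show ?thesis by (rule finite_subset) simp
qed

lemma parts_add_mset [simp]:
  "left_part (add_mset (Inl v) m) = add_mset v (left_part m)"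
  "left_part (add_mset (Inr w) m) = left_part m"
  "right_part (add_mset (Inl v) m) = right_part m"
  "right_part (add_mset (Inr w) m) = add_mset w (right_part m)"
  by (simp_all add: left_part_def right_part_def)

lemma count_parts [simp]:
  "count (left_part m) v = count m (Inl v)"
  "count (right_part m) w = count m (Inr w)"
proof -
  show "count (left_part m) v = count m (Inl v)"
  proof (induction m)
    case (add x m)
    then show ?case by (cases x) auto
  qed (simp add: left_part_def)
  show "count (right_part m) w = count m (Inr w)"
  proof (induction m)
    case (add x m)
    then show ?case by (cases x) auto
  qed (simp add: right_part_def)
qed

lemma in_parts [simp]:
  "v \<in># left_part m \<longleftrightarrow> Inl v \<in># m"
  "w \<in># right_part m \<longleftrightarrow> Inr w \<in># m"
  by (metis count_eq_zero_iff count_parts)+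

lemma deriv_tensor:
  "mfps_deriv (Inl v) (F \<otimes> G) = mfps_deriv v F \<otimes> G"
  "mfps_deriv (Inr w) (F \<otimes> G) = F \<otimes> mfps_deriv w G"
  by (simp_all add: mfps_deriv_def tensor_def mult_ac)

lemma var_mult_tensor:
  "mfps_var (Inl v) * (F \<otimes> G) = (mfps_var v * F) \<otimes> G"
  "mfps_var (Inr w) * (F \<otimes> G) = F \<otimes> (mfps_var w * G)"
  by (rule mfps_eqI, auto simp: coeff_var_mult tensor_def dest!: multi_member_split)+

lemma omega_term_tensor:
  "omega_term i (F \<otimes> G) = phi_star id i F \<otimes> phi id (- i) G"
proof -
  have "phi Inr (- i) (F \<otimes> G) = F \<otimes> phi id (- i) G"
    by (simp add: phi_def deriv_tensor var_mult_tensor)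
  moreover have "phi_star Inl i (F \<otimes> H) = phi_star id i F \<otimes> H" for H :: "fock_var mfps"
    by (auto simp: phi_star_def deriv_tensor var_mult_tensor)
       (simp add: tensor_def uminus_mfps_def)
  ultimately show ?thesis by (simp add: omega_term_def)
qed

lemma deriv_var_mult:
  "mfps_deriv v (mfps_var w * F) = mfps_var w * mfps_deriv v F + (if v = w then F else 0)"
  by (rule mfps_eqI)
    (auto simp: mfps_deriv_def coeff_var_mult plus_mfps_def zero_mfps_def distrib_right
      not_in_iff dest!: multi_member_split)

lemma deriv_commute: "mfps_deriv v (mfps_deriv w F) = mfps_deriv w (mfps_deriv v F)"
  by (rule mfps_eqI) (auto simp: mfps_deriv_def add_mset_commute)

lemma deriv_uminus: "mfps_deriv v (- F) = - mfps_deriv v F"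
  by (rule mfps_eqI) (simp add: mfps_deriv_def uminus_mfps_def)

lemma phi_phi_star_commutator:
  assumes "inj e"
  shows "phi e i (phi_star e j F) - phi_star e j (phi e i F) = (if i = - j then F else 0)"
  using assms
  by (auto simp: phi_def phi_star_def deriv_var_mult deriv_uminus deriv_commute
      inj_eq mult.left_commute nat_eq_iff)

lemma phi_commute: "inj e \<Longrightarrow> phi e i (phi e j F) = phi e j (phi e i F)"
  by (auto simp: phi_def deriv_var_mult deriv_commute inj_eq mult.left_commute)

lemma phi_star_commute: "inj e \<Longrightarrow> phi_star e i (phi_star e j F) = phi_star e j (phi_star e i F)"
  by (auto simp: phi_star_def deriv_var_mult deriv_uminus deriv_commute inj_eq
      mult.left_commute)

lemma phi_vacuum: "0 \<le> i \<Longrightarrow> phi id i vacuum = 0" "0 \<le> i \<Longrightarrow> phi_star id (i + 1) vacuum = 0"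
  by (auto simp: phi_def phi_star_def mfps_deriv_def one_mfps_def zero_mfps_def uminus_mfps_def)

text \<open>
  The exponent is the series of the products of the commuting creation operators \<open>\<phi>\<^sup>*\<close> with index
  \<open>- i\<close> and \<open>\<phi>\<close> with index \<open>- j\<close>, which act by multiplication by variables.
\<close>

definition tau :: "(nat \<Rightarrow> nat \<Rightarrow> complex) \<Rightarrow> fock_var mfps" where
  "tau c = mfps_exp (\<Sum>(i, j) | 0 < j \<and> c i j \<noteq> 0.
      mfps_const (c i j) * mfps_var (PhiStar i) * mfps_var (Phi (j - 1))) * vacuum"

lemma coeff_exponent_eq_0:
  "coeff (\<Sum>(i, j)\<in>A. mfps_const (c i j) * mfps_var (PhiStar i) * mfps_var (Phi (j - 1))) {#} = 0"
proof (induction A rule: infinite_finite_induct)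
  case (insert x A)
  then show ?case
    by (cases x) (simp add: plus_mfps_def mult.assoc times_mfps_def mfps_var_def)
qed (simp_all add: zero_mfps_def)

end

(* Since tau is an exponential, an annihilation operator, being up to sign a derivation of the
   Fock space, multiplies tau by a linear form: phi_n tau = (SUM j. c n j phi_{-j}) tau for n >= 0 and
   phi*_j tau = - (SUM n. c n j phi*_{-n}) tau for j > 0. Hence both halves i <= 0 and i > 0 of
   Omega_U (tau (x) tau) are, up to opposite signs, the finite sum of all
   c n j (phi*_{-n} tau) (x) (phi_{-j} tau), and they cancel. *)

theory Submission
  imports Defs
begin

section \<open>Coefficients and derivations of power series\<close>

lemma coeff_simps [simp]:
  "coeff 0 m = 0" "coeff (F + G) m = coeff F m + coeff G m" "coeff (- F) m = - coeff F m"
  by (simp_all add: zero_mfps_def plus_mfps_def uminus_mfps_def)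

lemma coeff_sum: "coeff (sum f A) m = (\<Sum>x\<in>A. coeff (f x) m)"
  by (induction A rule: infinite_finite_induct) simp_all

lemma coeff_mult: "coeff (F * G) m = (\<Sum>a | a \<subseteq># m. coeff F a * coeff G (m - a))"
  by (simp add: times_mfps_def)

lemma coeff_const_mult [simp]: "coeff (mfps_const c * F) m = c * coeff F m"
proof -
  have "coeff (mfps_const c * F) m = (\<Sum>a | a \<subseteq># m. if a = {#} then c * coeff F m else 0)"
    unfolding coeff_mult by (rule sum.cong) (auto simp: mfps_const_def)
  then show ?thesis by (simp add: sum.delta)
qed

lemma coeff_deriv: "coeff (mfps_deriv v F) m = of_nat (count m v + 1) * coeff F (add_mset v m)"
  by (simp add: mfps_deriv_def)

lemma deriv_sum: "mfps_deriv v (sum f A) = (\<Sum>x\<in>A. mfps_deriv v (f x))"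
  by (rule mfps_eqI) (simp add: coeff_deriv coeff_sum sum_distrib_left)

lemma deriv_const_mult: "mfps_deriv v (mfps_const c * F) = mfps_const c * mfps_deriv v F"
  by (rule mfps_eqI) (simp add: coeff_deriv)

lemma deriv_one [simp]: "mfps_deriv v 1 = 0"
  by (rule mfps_eqI) (simp add: coeff_deriv one_mfps_def)

text \<open>Multisets \<open>a\<close> without \<open>v\<close> carry weight 0; every other one is
  \<open>add_mset v b\<close> with \<open>b \<subseteq># m\<close>, which recovers the Cauchy
  product at \<open>m\<close>. Summing over the submultisets of \<open>add_mset v m\<close> gives
  both Leibniz terms the same range.\<close>

lemma coeff_deriv_mult:
  "coeff (mfps_deriv v F * G) m =
    (\<Sum>a | a \<subseteq># add_mset v m. of_nat (count a v) * (coeff F a * coeff G (add_mset v m - a)))"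
  (is "_ = sum ?f ?A")
proof -
  have "sum ?f ?A = sum ?f (add_mset v ` {a. a \<subseteq># m})"
  proof (rule sum.mono_neutral_right)
    show "\<forall>a\<in>?A - add_mset v ` {a. a \<subseteq># m}. ?f a = 0"
    proof
      fix a assume a: "a \<in> ?A - add_mset v ` {a. a \<subseteq># m}"
      have "v \<notin># a"
      proof
        assume "v \<in># a"
        then obtain b where "a = add_mset v b" by (meson multi_member_split)
        with a show False by auto
      qed
      then show "?f a = 0" by (simp add: not_in_iff)
    qed
  qed auto
  also have "\<dots> = (\<Sum>a | a \<subseteq># m. ?f (add_mset v a))"
    by (subst sum.reindex) (auto simp: inj_on_def)
  also have "\<dots> = coeff (mfps_deriv v F * G) m"
    by (simp add: coeff_mult coeff_deriv mult.assoc)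
  finally show ?thesis ..
qed

text \<open>The multiplicity of \<open>v\<close> in \<open>add_mset v m\<close> is shared between a
  submultiset and its complement, so the weights of the two Leibniz terms add up to
  \<open>count m v + 1\<close>.\<close>

lemma deriv_mult: "mfps_deriv v (F * G) = mfps_deriv v F * G + F * mfps_deriv v G"
proof (rule mfps_eqI)
  fix m
  let ?m = "add_mset v m"
  have "coeff (F * mfps_deriv v G) m = coeff (mfps_deriv v G * F) m"
    by (simp add: mult.commute)
  also have "\<dots> = (\<Sum>a | a \<subseteq># ?m. of_nat (count a v) * (coeff G a * coeff F (?m - a)))"
    by (rule coeff_deriv_mult)
  \<comment> \<open>Passing to complements restores the order of the factors and moves the weight to
    \<open>?m - a\<close>.\<close>
  also have "\<dots> = (\<Sum>a | a \<subseteq># ?m. of_nat (count (?m - a) v) * (coeff F a * coeff G (?m - a)))"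
    by (rule sum.reindex_bij_witness[where i = "\<lambda>a. ?m - a" and j = "\<lambda>a. ?m - a"])
      (auto simp: subset_mset.diff_diff_right)
  finally have *: "coeff (F * mfps_deriv v G) m = \<dots>" .
  have "of_nat (count a v) + of_nat (count (?m - a) v) = (of_nat (count m v + 1) :: complex)"
    if "a \<subseteq># ?m" for a
  proof -
    have "count a v \<le> count ?m v" using that by (rule mset_subset_eq_count)
    then have "count a v + count (?m - a) v = count m v + 1" by simp
    then show ?thesis by (metis of_nat_add)
  qed
  then show "coeff (mfps_deriv v (F * G)) m = coeff (mfps_deriv v F * G + F * mfps_deriv v G) m"
    unfolding coeff_simps * coeff_deriv_mult sum.distrib[symmetric] distrib_right[symmetric]
    by (simp add: coeff_deriv coeff_mult sum_distrib_left)
qed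

lemma deriv_power:
  "mfps_deriv v (F ^ Suc k) = mfps_const (of_nat (Suc k)) * (mfps_deriv v F * F ^ k)"
proof (induction k)
  case 0
  show ?case by (rule mfps_eqI) simp
next
  case (Suc k)
  have "mfps_deriv v (F ^ Suc (Suc k)) =
      mfps_deriv v F * F ^ Suc k + F * (mfps_const (of_nat (Suc k)) * (mfps_deriv v F * F ^ k))"
    by (simp only: power_Suc[of F "Suc k"] deriv_mult Suc.IH)
  also have "\<dots> = mfps_deriv v F * F ^ Suc k +
      mfps_const (of_nat (Suc k)) * (mfps_deriv v F * F ^ Suc k)"
    by (simp add: mult_ac)
  also have "\<dots> = mfps_const (of_nat (Suc (Suc k))) * (mfps_deriv v F * F ^ Suc k)"
    by (rule mfps_eqI) (simp del: power_Suc add: distrib_right)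
  finally show ?case .
qed

text \<open>Without constant term, each coefficient of the exponential is a finite sum over powers,
  so differentiation may go term by term.\<close>

lemma deriv_exp:
  assumes "coeff F {#} = 0"
  shows "mfps_deriv v (mfps_exp F) = mfps_deriv v F * mfps_exp F"
proof (rule mfps_eqI)
  fix m
  \<comment> \<open>The derivative at \<open>m\<close> reads the coefficient at
    \<open>add_mset v m\<close>, hence a bound one above \<open>size m\<close>.\<close>
  have "coeff (mfps_deriv v (mfps_exp F)) m =
      (\<Sum>k\<le>Suc (size m). coeff (mfps_deriv v (F ^ k)) m / fact k)"
    by (simp add: coeff_deriv coeff_mfps_exp assms sum_distrib_left sum_divide_distrib
        distrib_left)
  \<comment> \<open>The term \<open>k = 0\<close> is the derivative of 1 and vanishes; in the
    others, shifted down by one, the factor \<open>Suc k\<close> turns \<open>fact (Suc k)\<close>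
    into \<open>fact k\<close>.\<close>
  also have "\<dots> = (\<Sum>k\<le>size m. coeff (mfps_deriv v F * F ^ k) m / fact k)"
    by (subst sum.atMost_Suc_shift)
      (simp add: deriv_power fact_Suc del: power_Suc of_nat_Suc)
  also have "\<dots> = (\<Sum>a | a \<subseteq># m. coeff (mfps_deriv v F) a *
      (\<Sum>k\<le>size m. coeff (F ^ k) (m - a) / fact k))"
    unfolding coeff_mult sum_divide_distrib sum_distrib_left
    by (subst sum.swap) simp
  also have "\<dots> = coeff (mfps_deriv v F * mfps_exp F) m"
    unfolding coeff_mult
  proof (rule sum.cong)
    fix a assume "a \<in> {a. a \<subseteq># m}"
    \<comment> \<open>Powers above \<open>size (m - a)\<close> contribute nothing, so the bound
      \<open>size m\<close>, common to all \<open>a\<close>, still gives the full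
      coefficient.\<close>
    have "(\<Sum>k\<le>size m. coeff (F ^ k) (m - a) / fact k) = coeff (mfps_exp F) (m - a)"
      unfolding coeff_mfps_exp[OF assms]
    proof (rule sum.mono_neutral_right)
      show "{..size (m - a)} \<subseteq> {..size m}"
        using size_mset_mono[OF diff_subset_eq_self] by fastforce
    qed (auto simp: coeff_power_eq_0[OF assms])
    then show "coeff (mfps_deriv v F) a * (\<Sum>k\<le>size m. coeff (F ^ k) (m - a) / fact k) =
      coeff (mfps_deriv v F) a * coeff (mfps_exp F) (m - a)" by simp
  qed simp
  finally show "coeff (mfps_deriv v (mfps_exp F)) m = coeff (mfps_deriv v F * mfps_exp F) m" .
qed

section \<open>Tensor products and the bosons acting on \<open>tau\<close>\<close>

lemma tensor_sum:
  "sum f A \<otimes> G = (\<Sum>x\<in>A. f x \<otimes> G)" "F \<otimes> sum g A = (\<Sum>x\<in>A. F \<otimes> g x)"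
  by (rule mfps_eqI; simp add: tensor_def coeff_sum sum_distrib_left sum_distrib_right)+

lemma tensor_const_mult:
  "(mfps_const c * F) \<otimes> G = mfps_const c * (F \<otimes> G)"
  "F \<otimes> (mfps_const c * G) = mfps_const c * (F \<otimes> G)"
  by (rule mfps_eqI; simp add: tensor_def mult.left_commute)+

lemma tensor_zero [simp]: "0 \<otimes> G = 0" "F \<otimes> 0 = 0"
  by (rule mfps_eqI; simp add: tensor_def)+

lemma tensor_uminus_left: "(- F) \<otimes> G = - (F \<otimes> G)"
  by (rule mfps_eqI) (simp add: tensor_def)

text \<open>The exponential rule leaves the derivative of a quadratic exponent, a linear form. One
  formula serves both kinds of variables, since at most one of the two conditions can hold.\<close>

lemma deriv_tau:
  "mfps_deriv v (tau c) = (\<Sum>(n, j) | 0 < j \<and> c n j \<noteq> 0. mfps_const (c n j) *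
      ((if v = PhiStar n then mfps_var (Phi (j - 1)) * tau c else 0) +
       (if v = Phi (j - 1) then mfps_var (PhiStar n) * tau c else 0)))"
proof -
  let ?S = "{(n, j). 0 < j \<and> c n j \<noteq> 0}"
  define E where
    "E = (\<Sum>(i, j)\<in>?S. mfps_const (c i j) * mfps_var (PhiStar i) * mfps_var (Phi (j - 1)))"
  have tau: "tau c = mfps_exp E" by (simp add: tau_def E_def)
  have "coeff E {#} = 0" unfolding E_def by (rule coeff_exponent_eq_0)
  then have "mfps_deriv v (tau c) = mfps_deriv v E * tau c"
    unfolding tau by (rule deriv_exp)
  moreover have "mfps_deriv v (mfps_var w) = (if v = w then 1 else 0)" for v w :: fock_var
    using deriv_var_mult[of v w 1] by simp
  then have "mfps_deriv v E = (\<Sum>(n, j)\<in>?S. mfps_const (c n j) *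
      ((if v = PhiStar n then mfps_var (Phi (j - 1)) else 0) +
       (if v = Phi (j - 1) then mfps_var (PhiStar n) else 0)))"
    unfolding E_def deriv_sum
    by (intro sum.cong) (auto simp: mult.assoc deriv_const_mult deriv_var_mult)
  ultimately show ?thesis
    by (auto simp: sum_distrib_right mult.assoc intro!: sum.cong)
qed

text \<open>For \<open>i \<le> 0\<close> the left factor is multiplied and the right one
  differentiated, which selects \<open>n = - i\<close>; for \<open>i > 0\<close> the roles swap,
  with a sign, and \<open>j = i\<close> is selected. As \<open>- int n \<le> 0 < int j\<close>, the
  two cases fit into one formula.\<close>

lemma omega_term_tau:
  "omega_term i (tau c \<otimes> tau c) = (\<Sum>(n, j) | 0 < j \<and> c n j \<noteq> 0.
      (if i = - int n then mfps_const (c n j) *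
        ((mfps_var (PhiStar n) * tau c) \<otimes> (mfps_var (Phi (j - 1)) * tau c)) else 0) -
      (if i = int j then mfps_const (c n j) *
        ((mfps_var (PhiStar n) * tau c) \<otimes> (mfps_var (Phi (j - 1)) * tau c)) else 0))"
proof (cases "i \<le> 0")
  case True
  then show ?thesis
    unfolding omega_term_tensor
    by (auto simp: phi_def phi_star_def deriv_tau tensor_sum tensor_const_mult nat_eq_iff
        case_prod_unfold intro!: sum.cong)
next
  case False
  then show ?thesis
    unfolding omega_term_tensor
    by (auto simp: phi_def phi_star_def deriv_tau tensor_sum tensor_const_mult
        tensor_uminus_left sum_negf[symmetric] case_prod_unfold intro!: sum.cong)
qed

text \<open>Replaces the summation range of \<open>Omega_U\<close>, which varies with the monomial,
  by a single finite one, so that sums can be exchanged at the level of series.\<close>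

lemma Omega_U_eq_sum:
  assumes "finite I" and "\<And>i. i \<notin> I \<Longrightarrow> omega_term i F = 0"
  shows "Omega_U F = (\<Sum>i\<in>I. omega_term i F)"
proof (rule mfps_eqI)
  fix m
  show "coeff (Omega_U F) m = coeff (\<Sum>i\<in>I. omega_term i F) m"
    unfolding Omega_U_def coeff_Abs coeff_sum
    using assms by (intro sum.mono_neutral_left) (auto, metis coeff_simps(1))
qed

theorem proposition3p2:
  fixes c :: "nat \<Rightarrow> nat \<Rightarrow> complex"
  assumes "finite {(i, j). 0 < j \<and> c i j \<noteq> 0}"
  shows "Omega_U (tau c \<otimes> tau c) = 0"
proof -
  let ?S = "{(n, j). 0 < j \<and> c n j \<noteq> 0}"
  \<comment> \<open>These are the indices at which some condition in \<open>omega_term_tau\<close>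
    can hold.\<close>
  let ?I = "(\<lambda>(n, j). - int n) ` ?S \<union> (\<lambda>(n, j). int j) ` ?S"
  have I: "finite ?I" using assms by simp
  have "omega_term i (tau c \<otimes> tau c) = 0" if "i \<notin> ?I" for i
    unfolding omega_term_tau using that by (intro sum.neutral) force
  with I have "Omega_U (tau c \<otimes> tau c) = (\<Sum>i\<in>?I. omega_term i (tau c \<otimes> tau c))"
    by (rule Omega_U_eq_sum)
  also have "\<dots> = 0"
    unfolding omega_term_tau
  \<comment> \<open>With the pair \<open>(n, j)\<close> outermost, the sum over \<open>i\<close>
    meets the same tensor once with plus, at \<open>- int n\<close>, and once with minus, at
    \<open>int j\<close>.\<close>
  proof (subst sum.swap, rule sum.neutral, safe)
    fix n j assume "0 < j" "c n j \<noteq> 0"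
    then have "- int n \<in> ?I" "int j \<in> ?I" by force+
    with I show "(\<Sum>i\<in>?I.
      (if i = - int n then mfps_const (c n j) *
        ((mfps_var (PhiStar n) * tau c) \<otimes> (mfps_var (Phi (j - 1)) * tau c)) else 0) -
      (if i = int j then mfps_const (c n j) *
        ((mfps_var (PhiStar n) * tau c) \<otimes> (mfps_var (Phi (j - 1)) * tau c)) else 0)) = 0"
      by (simp add: sum_subtractf sum.delta del: Un_iff)
  qed
  finally show ?thesis .
qed

end
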